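(* Let $G$ be a circle graph with clique number $\omega$. Then the chromatic number of $G$ is at most $7\omega^2$.
   Context: An interval system is a finite set $\mathcal{I}$ of open intervals $(a,b)$, $a<b$, contained in $(0,1)$, such that no two distinct intervals share an end and no interval has $0$ or $1$ as an end. Two intervals overlap if they intersect and neither is contained in the other. The overlap graph $G(\mathcal{I})$ is the graph with vertex set $\mathcal{I}$ in which two vertices are adjacent if and only if they overlap as intervals. A graph is a circle graph if it is isomorphic to the overlap graph of an interval system (equivalently, it is the intersection graph of a finite set of chords of a circle). *)

theory Defs
  imports Complex_Main "Graph_Theory.Graph_Theory"
begin

text \<open>
  The locale \<^locale>\<open>graph\<close> describes finite simple graphs, each undirected edge being
  represented by two opposite arcs; adjacency is \<open>u \<rightarrow>\<^bsub>G\<^esub> v\<close>.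
\<close>

definition interval_ends :: "real set \<Rightarrow> real set" where
  "interval_ends J = {Inf J, Sup J}"

lemma interval_ends_eq: "a < b \<Longrightarrow> interval_ends {a<..<b} = {a, b}"
  by (simp add: interval_ends_def)

definition interval_system :: "real set set \<Rightarrow> bool" where
  "interval_system \<I> \<longleftrightarrow>
     finite \<I> \<and>
     (\<forall>J\<in>\<I>. (\<exists>a b. a < b \<and> J = {a<..<b}) \<and> J \<subseteq> {0<..<1} \<and>
            0 \<notin> interval_ends J \<and> 1 \<notin> interval_ends J) \<and>
     (\<forall>J\<in>\<I>. \<forall>K\<in>\<I>. J \<noteq> K \<longrightarrow> interval_ends J \<inter> interval_ends K = {})"

definition overlap :: "real set \<Rightarrow> real set \<Rightarrow> bool" where
  "overlap J K \<longleftrightarrow> J \<inter> K \<noteq> {} \<and> \<not> J \<subseteq> K \<and> \<not> K \<subseteq> J"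

definition overlap_graph :: "real set set \<Rightarrow> real set pair_pre_digraph" where
  "overlap_graph \<I> = \<lparr>pverts = \<I>, parcs = {(J, K). J \<in> \<I> \<and> K \<in> \<I> \<and> overlap J K}\<rparr>"

lemma pair_graph_overlap_graph:
  assumes "finite \<I>"
  shows "pair_graph (overlap_graph \<I>)"
proof -
  have "parcs (overlap_graph \<I>) \<subseteq> \<I> \<times> \<I>"
    by (auto simp: overlap_graph_def)
  then have "finite (parcs (overlap_graph \<I>))"
    using assms by (meson finite_SigmaI finite_subset)
  then show ?thesis
    using assms
    by unfold_locales (auto simp: overlap_graph_def overlap_def symmetric_def sym_def)
qed

definition circle_graph :: "('a, 'b) pre_digraph \<Rightarrow> bool" where
  "circle_graph G \<longleftrightarrow>
     (\<exists>\<I>. interval_system \<I> \<and> digraph_iso G (with_proj (overlap_graph \<I>)))"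

lemma circle_graph_imp_graph:
  assumes "circle_graph G"
  shows "graph G"
proof -
  from assms obtain \<I> f where I: "interval_system \<I>"
    and f: "pre_digraph.digraph_isomorphism G f"
    and H: "with_proj (overlap_graph \<I>) = app_iso f G"
    by (auto simp: circle_graph_def digraph_iso_def)
  interpret wf_digraph G
    using f by (simp add: pre_digraph.digraph_isomorphism_def)
  interpret P: pair_graph "overlap_graph \<I>"
    using I by (intro pair_graph_overlap_graph) (simp add: interval_system_def)
  have gH: "graph (app_iso f G)"
    using P.pair_graphD_graph H by simp
  interpret H: graph "app_iso f G" by (rule gH)
  have finV: "finite (verts G)"
    using f H.finite_verts
    by (auto simp: digraph_isomorphism_def dest: finite_imageD)
  have finA: "finite (arcs G)"
    using f H.finite_arcs
    by (auto simp: digraph_isomorphism_def dest: finite_imageD)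
  have inj: "inj_on (iso_arcs f) (arcs G)" and injv: "inj_on (iso_verts f) (verts G)"
    using f by (auto simp: digraph_isomorphism_def)
  have loop: "tail G e \<noteq> head G e" if "e \<in> arcs G" for e
  proof
    assume "tail G e = head G e"
    then have "iso_tail f (iso_arcs f e) = iso_head f (iso_arcs f e)"
      using f that by (simp add: iso_verts_tail iso_verts_head)
    then show False
      using H.no_loops[of "iso_arcs f e"] that by simp
  qed
  have multi: "e1 = e2"
    if "e1 \<in> arcs G" "e2 \<in> arcs G" "arc_to_ends G e1 = arc_to_ends G e2" for e1 e2
  proof -
    have "arc_to_ends (app_iso f G) (iso_arcs f e1) = arc_to_ends (app_iso f G) (iso_arcs f e2)"
      using f that by (simp add: arc_to_ends_def iso_verts_tail iso_verts_head)
    then have "iso_arcs f e1 = iso_arcs f e2"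
      using H.no_multi_arcs[of "iso_arcs f e1" "iso_arcs f e2"] that by simp
    then show ?thesis
      using inj that by (auto dest: inj_onD)
  qed
  have "symmetric G"
    unfolding symmetric_def
  proof (rule symI)
    fix u v assume uv: "(u, v) \<in> arcs_ends G"
    then have V: "u \<in> verts G" "v \<in> verts G" by auto
    have "(iso_verts f u, iso_verts f v) \<in> arcs_ends (app_iso f G)"
      using f uv by (force simp: arcs_ends_app_iso_eq)
    then have "(iso_verts f v, iso_verts f u) \<in> arcs_ends (app_iso f G)"
      using H.sym_arcs by (auto simp: symmetric_def dest: symD)
    then obtain x y where xy: "(x, y) \<in> arcs_ends G"
      and eq: "iso_verts f x = iso_verts f v" "iso_verts f y = iso_verts f u"
      using f by (auto simp: arcs_ends_app_iso_eq)
    from xy have "x \<in> verts G" "y \<in> verts G" by auto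
    then have "x = v" "y = u"
      using eq V injv by (auto dest: inj_onD)
    then show "(v, u) \<in> arcs_ends G" using xy by simp
  qed
  then show ?thesis
    using finV finA loop multi by unfold_locales auto
qed

definition clique :: "('a, 'b) pre_digraph \<Rightarrow> 'a set \<Rightarrow> bool" where
  "clique G K \<longleftrightarrow> K \<subseteq> verts G \<and> (\<forall>u\<in>K. \<forall>v\<in>K. u \<noteq> v \<longrightarrow> u \<rightarrow>\<^bsub>G\<^esub> v)"

definition clique_number :: "('a, 'b) pre_digraph \<Rightarrow> nat" where
  "clique_number G = Max (card ` {K. clique G K})"

definition proper_coloring :: "('a, 'b) pre_digraph \<Rightarrow> nat \<Rightarrow> ('a \<Rightarrow> nat) \<Rightarrow> bool" where
  "proper_coloring G k c \<longleftrightarrow>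
     c ` verts G \<subseteq> {..<k} \<and>
     (\<forall>u\<in>verts G. \<forall>v\<in>verts G. u \<rightarrow>\<^bsub>G\<^esub> v \<longrightarrow> c u \<noteq> c v)"

definition chromatic_number :: "('a, 'b) pre_digraph \<Rightarrow> nat" where
  "chromatic_number G = (LEAST k. \<exists>c. proper_coloring G k c)"

text \<open>On finite simple graphs the maximum and the minimum are attained.\<close>

lemma (in graph) clique_number_attained:
  "finite (card ` {K. clique G K})" "\<exists>K. clique G K \<and> card K = clique_number G"
proof -
  have "{K. clique G K} \<subseteq> Pow (verts G)" by (auto simp: clique_def)
  then show fin: "finite (card ` {K. clique G K})"
    by (meson finite_Pow_iff finite_imageI finite_subset finite_verts)
  have "clique G {}" by (simp add: clique_def)
  then have "clique_number G \<in> card ` {K. clique G K}"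
    unfolding clique_number_def using fin by (intro Max_in) auto
  then show "\<exists>K. clique G K \<and> card K = clique_number G" by auto
qed

lemma (in graph) chromatic_number_attained: "\<exists>c. proper_coloring G (chromatic_number G) c"
  unfolding chromatic_number_def
proof (rule LeastI_ex)
  obtain c where c: "inj_on c (verts G)" "c ` verts G = {..<card (verts G)}"
    using finite_imp_inj_to_nat_seg[OF finite_verts]
    by (metis card_Collect_less_nat card_image lessThan_def)
  have "proper_coloring G (card (verts G)) c"
    unfolding proper_coloring_def using c adj_not_same by (auto dest: inj_onD)
  then show "\<exists>k c. proper_coloring G k c" by blast
qed

end

theory Submission
  imports Defs
begin

text \<open>
  Cut the line at points called pillars, introduced one after the other, and assign every interval
  to the first pillar it contains. The intervals on one pillar form a permutation graph, coloured
  perfectly by \<open>\<omega>\<close> colours, so it remains to give palettes to the pillars such that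
  overlapping intervals on distinct pillars receive distinct palettes. A new pillar in a segment
  between old ones only has to avoid the palettes of the pillars seen by the segment, namely those
  with an interval that has exactly one end in it; so \<open>7 \<omega>\<close> palettes suffice if new pillars can
  be placed such that no segment ever sees \<open>7 \<omega>\<close> pillars. When a segment sees \<open>K = 7 \<omega> - D\<close>
  pillars, it is cut by a binary tree of \<open>2 ^ D - 1\<close> new pillars, of which each part sees at most
  \<open>D\<close>, such that each part sees at most \<open>K - D\<close> old ones. If this is impossible, there are
  \<open>2 ^ D\<close> successive subsegments each missing fewer than \<open>D\<close> of the at least \<open>K / 2\<close>
  pillars seen from one side. Averaging over the diagonals of the incidence table of pillars and
  subsegments then gives more than \<open>\<omega>\<close> pillars with intervals ending in the order of the
  pillars, which overlap pairwise.
\<close>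

section \<open>Binary cut trees\<close>

text \<open>The leaves are \<open>2 ^ d\<close> successive segments. Cuts at an end of a segment are
  allowed, so a tree may contain fewer than \<open>2 ^ d - 1\<close> genuine cuts.\<close>

primrec cut_tree :: "(nat \<Rightarrow> nat \<Rightarrow> bool) \<Rightarrow> nat \<Rightarrow> nat \<Rightarrow> nat \<Rightarrow> bool" where
  "cut_tree Q 0 a b \<longleftrightarrow> Q a b"
| "cut_tree Q (Suc d) a b \<longleftrightarrow> (\<exists>q. a \<le> q \<and> q \<le> b \<and> cut_tree Q d a q \<and> cut_tree Q d q b)"

lemma cut_tree_mono:
  assumes "cut_tree Q d a b" "a \<le> b"
    and "\<And>x y. \<lbrakk>a \<le> x; x \<le> y; y \<le> b; Q x y\<rbrakk> \<Longrightarrow> Q' x y"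
  shows "cut_tree Q' d a b"
  using assms
proof (induction d arbitrary: a b)
  case (Suc d)
  then obtain q where q: "a \<le> q" "q \<le> b" "cut_tree Q d a q" "cut_tree Q d q b" by auto
  have "cut_tree Q' d a q"
    by (rule Suc.IH[OF q(3,1)]) (use q Suc.prems in \<open>meson order_trans\<close>)
  moreover have "cut_tree Q' d q b"
    by (rule Suc.IH[OF q(4,2)]) (use q Suc.prems in \<open>meson order_trans\<close>)
  ultimately show ?case using q by auto
qed simp

lemma cut_tree_trivial: "Q x x \<Longrightarrow> cut_tree Q d x x"
  by (induction d) auto

text \<open>Greedy cutting. Successive bad segments share one position, which is harmless because an
  increasing transversal picks distinct ends.\<close>

lemma no_cut_tree:
  assumes "\<not> cut_tree Q d a b" "a \<le> b" "\<And>x. Q x x"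
  obtains t where "t 0 = a" "mono t" "Suc (t (2 ^ d)) = b"
    "\<And>j. j < 2 ^ d \<Longrightarrow> \<not> Q (t j) (Suc (t (Suc j)))"
proof -
  have "\<exists>t. t 0 = a \<and> mono t \<and> Suc (t (2 ^ d)) = b \<and> (\<forall>j<2 ^ d. \<not> Q (t j) (Suc (t (Suc j))))"
    using assms(1,2)
  proof (induction d arbitrary: a b)
    case 0
    then have "a < b" using assms(3) by (metis cut_tree.simps(1) le_neq_implies_less)
    then show ?case using 0
      by (intro exI[of _ "\<lambda>j. if j = 0 then a else b - 1"]) (auto simp: mono_def)
  next
    case (Suc d)
    define S where "S = {q. a \<le> q \<and> q \<le> b \<and> cut_tree Q d a q}"
    have "a \<in> S" using Suc.prems(2) cut_tree_trivial[of Q a d] assms(3) by (auto simp: S_def)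
    have "finite S" by (rule finite_subset[of _ "{..b}"]) (auto simp: S_def)
    \<comment> \<open>\<open>q\<close> is the last point up to which depth \<open>d\<close>
      suffices. So neither \<open>q\<close> to \<open>b\<close> nor \<open>a\<close> to
      \<open>Suc q\<close> can be cut, and the two sequences found by induction meet in
      \<open>q\<close>.\<close>
    define q where "q = Max S"
    have qS: "q \<in> S" unfolding q_def using \<open>finite S\<close> \<open>a \<in> S\<close> by (auto intro: Max_in)
    then have nq: "\<not> cut_tree Q d q b" using Suc.prems by (auto simp: S_def)
    then have "q \<noteq> b" using cut_tree_trivial[of Q b d] assms(3) by auto
    then have "q < b" using qS by (auto simp: S_def)
    have aq: "a \<le> q" using qS by (simp add: S_def)
    have "Suc q \<notin> S" unfolding q_def using Max_ge[OF \<open>finite S\<close>, of "Suc (Max S)"] by linarith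
    then have nq': "\<not> cut_tree Q d a (Suc q)" using qS \<open>q < b\<close> by (simp add: S_def)
    obtain t1 where t1: "t1 0 = a" "mono t1" "Suc (t1 (2 ^ d)) = Suc q"
      "\<forall>j<2 ^ d. \<not> Q (t1 j) (Suc (t1 (Suc j)))"
      using Suc.IH[OF nq' le_SucI[OF aq]] by blast
    obtain t2 where t2: "t2 0 = q" "mono t2" "Suc (t2 (2 ^ d)) = b"
      "\<forall>j<2 ^ d. \<not> Q (t2 j) (Suc (t2 (Suc j)))"
      using Suc.IH[OF nq less_imp_le[OF \<open>q < b\<close>]] by blast
    define t where "t j = (if j < 2 ^ d then t1 j else t2 (j - 2 ^ d))" for j
    have le: "t1 j \<le> q" if "j \<le> 2 ^ d" for j
      using t1(2,3) monoD[OF t1(2) that] by simp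
    have ge: "q \<le> t2 j" for j
      using t2(1) monoD[OF t2(2), of 0 j] by simp
    have tle: "t j = t1 j" if "j \<le> 2 ^ d" for j
      using that t1 t2 by (auto simp: t_def le_less)
    have "mono t"
      unfolding mono_def t_def using t1(2) t2(2) order_trans[OF le ge]
      by (auto simp: mono_def)
    moreover have "\<not> Q (t j) (Suc (t (Suc j)))" if "j < 2 ^ Suc d" for j
    proof (cases "j < 2 ^ d")
      case True
      then show ?thesis using t1(4) tle[of j] tle[of "Suc j"] by auto
    next
      case False
      then show ?thesis using t2(4)[rule_format, of "j - 2 ^ d"] that
        by (auto simp: t_def Suc_diff_le)
    qed
    moreover have "t 0 = a" "Suc (t (2 ^ Suc d)) = b" using t1 t2 by (auto simp: t_def)
    ultimately show ?case by blast
  qed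
  then show thesis using that by blast
qed

section \<open>Averaging and increasing transversals\<close>

text \<open>Double counting of the misses on the \<open>k - N + 1\<close> full diagonals: at most
  \<open>w\<close> hits on each would leave at least \<open>N - w\<close> misses on each, while each
  of the \<open>N\<close> columns contains at most \<open>m\<close> misses.\<close>

lemma diagonal_averaging:
  fixes Pr :: "nat \<Rightarrow> nat \<Rightarrow> bool"
  assumes "N \<le> k" "\<And>j. j < N \<Longrightarrow> card {i. i < k \<and> \<not> Pr i j} \<le> m"
    and less: "N * m < (N - w) * (k - N + 1)"
  obtains s where "s \<le> k - N" "w < card {j. j < N \<and> Pr (s + j) j}"
proof (rule ccontr)
  note found = that
  assume no: "\<not> thesis"
  have le: "card {j. j < N \<and> Pr (s + j) j} \<le> w" if "s < k - N + 1" for s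
    using that no found[of s] by linarith
  have cd: "card {x \<in> A. P x} = (\<Sum>x\<in>A. if P x then 1 else 0)" if "finite A" for P and A :: "nat set"
    using that by (simp add: sum.If_cases Int_def)
  have "N - w \<le> card {j\<in>{..<N}. \<not> Pr (s + j) j}" if "s < k - N + 1" for s
  proof -
    have "{..<N} - {j. j < N \<and> Pr (s + j) j} = {j\<in>{..<N}. \<not> Pr (s + j) j}" by auto
    moreover have "card ({..<N} - {j. j < N \<and> Pr (s + j) j})
        = card {..<N} - card {j. j < N \<and> Pr (s + j) j}"
      by (rule card_Diff_subset) auto
    ultimately show ?thesis using le[OF that] by simp
  qed
  then have "(\<Sum>s<k - N + 1. N - w) \<le> (\<Sum>s<k - N + 1. card {j\<in>{..<N}. \<not> Pr (s + j) j})"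
    by (intro sum_mono) auto
  also have "\<dots> = (\<Sum>j<N. card {s\<in>{..<k - N + 1}. \<not> Pr (s + j) j})"
    unfolding cd[OF finite_lessThan] by (rule sum.swap)
  also have "\<dots> \<le> (\<Sum>j<N. m)"
  proof (rule sum_mono)
    fix j assume j: "j \<in> {..<N}"
    have "card {s\<in>{..<k - N + 1}. \<not> Pr (s + j) j} = card ((\<lambda>s. s + j) ` {s\<in>{..<k - N + 1}. \<not> Pr (s + j) j})"
      by (rule card_image[symmetric]) (auto simp: inj_on_def)
    also have "\<dots> \<le> card {i. i < k \<and> \<not> Pr i j}"
      using j assms(1) by (intro card_mono) auto
    also have "\<dots> \<le> m" using assms(2) j by auto
    finally show "card {s\<in>{..<k - N + 1}. \<not> Pr (s + j) j} \<le> m" .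
  qed
  finally show False using less by (simp only: sum_constant card_lessThan of_nat_id mult.commute)
qed

text \<open>Rows are the values of \<open>\<pi>\<close> in increasing order, columns the segments
  between successive \<open>t j\<close>. Take one element per incidence on a rich diagonal: along
  it, the rows force \<open>f\<close> to grow and the columns force \<open>h\<close> to
  grow.\<close>

lemma increasing_transversal:
  fixes f h \<pi> :: "'a \<Rightarrow> nat"
  assumes fin: "finite Y" and inj: "inj_on h Y"
    and ord: "\<And>y z. \<lbrakk>y \<in> Y; z \<in> Y; \<pi> y < \<pi> z\<rbrakk> \<Longrightarrow> f y < f z"
    and t: "mono t"
    and miss: "\<And>j. j < N \<Longrightarrow>
      card (\<pi> ` Y) \<le> card (\<pi> ` {y \<in> Y. t j \<le> h y \<and> h y < Suc (t (Suc j))}) + m"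
    and k: "N \<le> card (\<pi> ` Y)" "N * m < (N - w) * (card (\<pi> ` Y) - N + 1)"
  obtains Z where "Z \<subseteq> Y" "w < card Z"
    "\<And>y z. \<lbrakk>y \<in> Z; z \<in> Z; y \<noteq> z\<rbrakk> \<Longrightarrow> f y < f z \<and> h y < h z \<or> f z < f y \<and> h z < h y"
proof -
  define xs where "xs = sorted_list_of_set (\<pi> ` Y)"
  define k where "k = card (\<pi> ` Y)"
  have len: "length xs = k" "set xs = \<pi> ` Y" "distinct xs"
    using fin by (auto simp: xs_def k_def)
  have less: "xs ! i < xs ! j" if "i < j" "j < k" for i j
    using strict_sorted_list_of_set[of "\<pi> ` Y"] that len(1)
    by (auto simp: xs_def sorted_wrt_iff_nth_less)
  define T where "T j = {y \<in> Y. t j \<le> h y \<and> h y < Suc (t (Suc j))}" for j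
  define Pr where "Pr i j \<longleftrightarrow> xs ! i \<in> \<pi> ` T j" for i j
  have Pr: "card {i. i < k \<and> \<not> Pr i j} \<le> m" if "j < N" for j
  proof -
    have "card {i. i < k \<and> \<not> Pr i j} = card ((!) xs ` {i. i < k \<and> \<not> Pr i j})"
      using len by (intro card_image[symmetric]) (auto simp: inj_on_def nth_eq_iff_index_eq)
    also have "\<dots> \<le> card (\<pi> ` Y - \<pi> ` T j)"
      using fin len by (intro card_mono) (auto simp: Pr_def set_conv_nth)
    also have "\<dots> = k - card (\<pi> ` T j)"
      unfolding k_def by (rule card_Diff_subset) (auto simp: T_def fin)
    also have "\<dots> \<le> m" using miss[OF that] by (simp add: T_def k_def)
    finally show ?thesis .
  qed
  obtain s where s: "s \<le> k - N" "w < card {j. j < N \<and> Pr (s + j) j}"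
    by (rule diagonal_averaging[OF k(1)[folded k_def] Pr k(2)[folded k_def]])
  define J where "J = {j. j < N \<and> Pr (s + j) j}"
  have "\<forall>j\<in>J. \<exists>y. y \<in> T j \<and> \<pi> y = xs ! (s + j)"
    by (auto simp: J_def Pr_def)
  then obtain y where y: "\<And>j. j \<in> J \<Longrightarrow> y j \<in> T j \<and> \<pi> (y j) = xs ! (s + j)"
    by metis
  have incr: "f (y i) < f (y j) \<and> h (y i) < h (y j)" if "i \<in> J" "j \<in> J" "i < j" for i j
  proof -
    have "s + j < k" using that s(1) k by (auto simp: J_def k_def)
    then have \<pi>: "\<pi> (y i) < \<pi> (y j)" using y that less[of "s + i" "s + j"] by auto
    have "h (y i) \<le> t (Suc i)" "t (Suc i) \<le> t j" "t j \<le> h (y j)"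
      using y[OF that(1)] y[OF that(2)] monoD[OF t] that(3) by (auto simp: T_def)
    moreover have "h (y i) \<noteq> h (y j)"
      using \<pi> inj y[OF that(1)] y[OF that(2)] by (auto simp: T_def dest: inj_onD)
    ultimately show ?thesis
      using ord \<pi> y[OF that(1)] y[OF that(2)] by (auto simp: T_def)
  qed
  have "inj_on y J"
    using incr by (intro inj_onI) (metis less_irrefl linorder_neqE_nat)
  show thesis
  proof (rule that)
    show "y ` J \<subseteq> Y" using y by (auto simp: T_def)
    show "w < card (y ` J)" using s(2) \<open>inj_on y J\<close> by (simp add: card_image J_def)
    show "f u < f v \<and> h u < h v \<or> f v < f u \<and> h v < h u"
      if "u \<in> y ` J" "v \<in> y ` J" "u \<noteq> v" for u v
      using that incr by (metis imageE linorder_neqE_nat)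
  qed
qed

section \<open>Chords, segments and pillars\<close>

locale chord_system =
  fixes X :: "'a set" and l r :: "'a \<Rightarrow> nat"
  assumes finite_chords: "finite X"
    and l_less_r: "x \<in> X \<Longrightarrow> l x < r x"
    and inj_l: "inj_on l X" and inj_r: "inj_on r X"
begin

definition crossing :: "'a \<Rightarrow> 'a \<Rightarrow> bool" where
  "crossing x y \<longleftrightarrow> l x < l y \<and> l y < r x \<and> r x < r y \<or> l y < l x \<and> l x < r y \<and> r y < r x"

lemma crossing_sym: "crossing x y \<longleftrightarrow> crossing y x"
  by (auto simp: crossing_def)

text \<open>The segment is \<open>{a..<b}\<close>; a chord with only one end in it is classified by
  the side on which its other end lies.\<close>

definition inside :: "nat \<Rightarrow> nat \<Rightarrow> 'a set" where
  "inside a b = {x \<in> X. a \<le> l x \<and> r x < b}"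

definition from_left :: "nat \<Rightarrow> nat \<Rightarrow> 'a set" where
  "from_left a b = {x \<in> X. l x < a \<and> a \<le> r x \<and> r x < b}"

definition from_right :: "nat \<Rightarrow> nat \<Rightarrow> 'a set" where
  "from_right a b = {x \<in> X. a \<le> l x \<and> l x < b \<and> b \<le> r x}"

lemmas seg_defs = inside_def from_left_def from_right_def

lemma finite_seg [simp]: "finite (inside a b)" "finite (from_left a b)" "finite (from_right a b)"
  by (auto simp: seg_defs finite_chords)

text \<open>A pillar at position \<open>q\<close> stands between the positions \<open>q - 1\<close> and \<open>q\<close>, and \<open>\<pi>\<close> assigns
  chords to pillars. The chords inside \<open>{a..<b}\<close> are still unassigned, hence ignored in the number
  of pillars seen by the subsegment \<open>{x..<y}\<close>.\<close>

definition seen :: "('a \<Rightarrow> nat) \<Rightarrow> nat \<Rightarrow> nat \<Rightarrow> nat \<Rightarrow> nat \<Rightarrow> nat" where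
  "seen \<pi> a b x y = card (\<pi> ` {v \<in> from_left a b. x \<le> r v \<and> r v < y})
                  + card (\<pi> ` {v \<in> from_right a b. x \<le> l v \<and> l v < y})"

text \<open>The second and the fourth clause hold because of two pillars seen from the same side, the
  farther one is older: otherwise its chords would belong to the nearer one.\<close>

definition pillars_ok :: "('a \<Rightarrow> nat) \<Rightarrow> nat \<Rightarrow> nat \<Rightarrow> bool" where
  "pillars_ok \<pi> a b \<longleftrightarrow>
     (\<forall>y\<in>from_left a b. l y < \<pi> y \<and> \<pi> y \<le> a) \<and>
     (\<forall>y\<in>from_left a b. \<forall>z\<in>from_left a b. \<pi> y < \<pi> z \<longrightarrow> \<pi> y \<le> l z) \<and>
     (\<forall>y\<in>from_right a b. b \<le> \<pi> y \<and> \<pi> y \<le> r y) \<and>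
     (\<forall>y\<in>from_right a b. \<forall>z\<in>from_right a b. \<pi> y < \<pi> z \<longrightarrow> r y < \<pi> z)"

text \<open>Here \<open>p\<close> maps pillars to palettes.\<close>

definition extends :: "nat \<Rightarrow> ('a \<Rightarrow> nat) \<Rightarrow> (nat \<Rightarrow> nat) \<Rightarrow> nat \<Rightarrow> nat \<Rightarrow> ('a \<Rightarrow> nat) \<Rightarrow> (nat \<Rightarrow> nat) \<Rightarrow> bool"
  where
  "extends P \<pi> p a b \<pi>' p' \<longleftrightarrow>
     (\<forall>x. x \<notin> inside a b \<longrightarrow> \<pi>' x = \<pi> x) \<and>
     (\<forall>q. q \<notin> {a<..<b} \<longrightarrow> p' q = p q) \<and>
     (\<forall>x\<in>inside a b. l x < \<pi>' x \<and> \<pi>' x \<le> r x \<and> p' (\<pi>' x) < P) \<and>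
     (\<forall>x\<in>inside a b. \<forall>y\<in>inside a b \<union> from_left a b \<union> from_right a b.
        crossing x y \<longrightarrow> p' (\<pi>' x) = p' (\<pi>' y) \<longrightarrow> \<pi>' x = \<pi>' y)"

lemma extendsD:
  assumes "extends P \<pi> p a b \<pi>' p'"
  shows "x \<notin> inside a b \<Longrightarrow> \<pi>' x = \<pi> x"
    and "q \<notin> {a<..<b} \<Longrightarrow> p' q = p q"
    and "x \<in> inside a b \<Longrightarrow> l x < \<pi>' x \<and> \<pi>' x \<le> r x \<and> p' (\<pi>' x) < P"
    and "\<lbrakk>x \<in> inside a b; y \<in> inside a b \<union> from_left a b \<union> from_right a b; crossing x y;
          p' (\<pi>' x) = p' (\<pi>' y)\<rbrakk> \<Longrightarrow> \<pi>' x = \<pi>' y"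
  using assms unfolding extends_def by blast+

section \<open>Inserting one pillar and merging the extensions on its two sides\<close>

definition assign :: "('a \<Rightarrow> nat) \<Rightarrow> nat \<Rightarrow> nat \<Rightarrow> nat \<Rightarrow> 'a \<Rightarrow> nat" where
  "assign \<pi> a b q x = (if x \<in> inside a b \<and> l x < q \<and> q \<le> r x then q else \<pi> x)"

text \<open>A chord with both ends before \<open>a\<close> is invisible from \<open>{a..<b}\<close>.
  Hence the part to the right of a cut can be treated after the part to the left.\<close>

lemma pillars_ok_cong:
  assumes "pillars_ok \<pi> a b" "\<And>x. x \<notin> inside a' b' \<Longrightarrow> \<pi>' x = \<pi> x" "b' \<le> a"
  shows "pillars_ok \<pi>' a b"
proof -
  have "\<pi>' y = \<pi> y" if "y \<in> from_left a b \<or> y \<in> from_right a b" for y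
    using assms(2,3) that l_less_r[of y] by (auto simp: seg_defs)
  then show ?thesis using assms(1) by (auto simp: pillars_ok_def)
qed

lemma seen_cong:
  assumes "\<And>x. x \<notin> inside a' b' \<Longrightarrow> \<pi>' x = \<pi> x" "b' \<le> a"
  shows "seen \<pi>' a b = seen \<pi> a b"
proof -
  have eq: "\<pi>' y = \<pi> y" if "y \<in> from_left a b \<or> y \<in> from_right a b" for y
    using assms that l_less_r[of y] by (auto simp: seg_defs)
  show ?thesis unfolding seen_def fun_eq_iff
    by (intro allI arg_cong2[where f = "(+)"] arg_cong[where f = card] image_cong refl) (auto intro: eq)
qed

text \<open>From either part, \<open>q\<close> is the nearest pillar on its side. A chord newly
  assigned to \<open>q\<close> has both ends in \<open>{a..<b}\<close>, while the older pillars seen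
  stand at or beyond \<open>a\<close> and \<open>b\<close>.\<close>

lemma pillars_ok_assign:
  assumes "pillars_ok \<pi> a b" "a < q" "q < b"
  shows "pillars_ok (assign \<pi> a b q) a q" "pillars_ok (assign \<pi> a b q) q b"
proof -
  let ?\<pi> = "assign \<pi> a b q"
  have L1: "y \<in> from_left a b \<and> ?\<pi> y = \<pi> y" if "y \<in> from_left a q" for y
    using that assms by (auto simp: assign_def seg_defs)
  have R1: "y \<in> from_right a b \<and> ?\<pi> y = \<pi> y \<or> ?\<pi> y = q \<and> q \<le> r y \<and> r y < b"
    if "y \<in> from_right a q" for y
    using that assms by (auto simp: assign_def seg_defs)
  have L2: "y \<in> from_left a b \<and> ?\<pi> y = \<pi> y \<or> ?\<pi> y = q \<and> l y < q \<and> a \<le> l y"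
    if "y \<in> from_left q b" for y
    using that assms by (auto simp: assign_def seg_defs)
  have R2: "y \<in> from_right a b \<and> ?\<pi> y = \<pi> y" if "y \<in> from_right q b" for y
    using that assms by (auto simp: assign_def seg_defs)
  have ok: "y \<in> from_left a b \<Longrightarrow> l y < \<pi> y \<and> \<pi> y \<le> a"
      "y \<in> from_left a b \<Longrightarrow> z \<in> from_left a b \<Longrightarrow> \<pi> y < \<pi> z \<Longrightarrow> \<pi> y \<le> l z"
      "y \<in> from_right a b \<Longrightarrow> b \<le> \<pi> y \<and> \<pi> y \<le> r y"
      "y \<in> from_right a b \<Longrightarrow> z \<in> from_right a b \<Longrightarrow> \<pi> y < \<pi> z \<Longrightarrow> r y < \<pi> z" for y z
    using assms(1) by (auto simp: pillars_ok_def)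
  show "pillars_ok ?\<pi> a q"
    unfolding pillars_ok_def
  proof (intro conjI ballI impI)
    fix y assume "y \<in> from_left a q" then show "l y < ?\<pi> y" "?\<pi> y \<le> a"
      using L1 ok(1) by auto
  next
    fix y z assume "y \<in> from_left a q" "z \<in> from_left a q" "?\<pi> y < ?\<pi> z" then show "?\<pi> y \<le> l z"
      using L1 ok(2) by auto
  next
    fix y assume "y \<in> from_right a q" then show "q \<le> ?\<pi> y" "?\<pi> y \<le> r y"
      using R1[of y] ok(3)[of y] assms by auto
  next
    fix y z assume "y \<in> from_right a q" "z \<in> from_right a q" "?\<pi> y < ?\<pi> z" then show "r y < ?\<pi> z"
      using R1[of y] R1[of z] ok(4)[of y z] ok(3)[of y] ok(3)[of z] assms by auto
  qed
  show "pillars_ok ?\<pi> q b"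
    unfolding pillars_ok_def
  proof (intro conjI ballI impI)
    fix y assume "y \<in> from_left q b" then show "l y < ?\<pi> y" "?\<pi> y \<le> q"
      using L2[of y] ok(1)[of y] assms by auto
  next
    fix y z assume "y \<in> from_left q b" "z \<in> from_left q b" "?\<pi> y < ?\<pi> z" then show "?\<pi> y \<le> l z"
      using L2[of y] L2[of z] ok(2)[of y z] ok(1)[of y] ok(1)[of z] assms by auto
  next
    fix y assume "y \<in> from_right q b" then show "b \<le> ?\<pi> y" "?\<pi> y \<le> r y"
      using R2 ok(3) by auto
  next
    fix y z assume "y \<in> from_right q b" "z \<in> from_right q b" "?\<pi> y < ?\<pi> z" then show "r y < ?\<pi> z"
      using R2 ok(4) by auto
  qed
qed

lemma card_image_insert_le:
  assumes "finite A" "\<And>y. y \<in> B \<Longrightarrow> \<pi>' y = q \<or> y \<in> A \<and> \<pi>' y = \<pi> y"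
  shows "card (\<pi>' ` B) \<le> card (\<pi> ` A) + 1"
proof -
  have "card (\<pi>' ` B) \<le> card (insert q (\<pi> ` A))"
    using assms by (intro card_mono) auto
  then show ?thesis
    using assms(1) card_insert_le_m1[of "card (\<pi> ` A) + 1" "\<pi> ` A" q] by simp
qed

text \<open>The chords that come into view of a part when it is cut off at \<open>q\<close> were
  unassigned and contain \<open>q\<close>, so \<open>q\<close> is the only additional
  pillar.\<close>

lemma seen_assign_le:
  assumes "a < q" "q < b"
  shows "y \<le> q \<Longrightarrow> seen (assign \<pi> a b q) a q x y \<le> seen \<pi> a b x y + 1"
    and "q \<le> x \<Longrightarrow> seen (assign \<pi> a b q) q b x y \<le> seen \<pi> a b x y + 1"
proof -
  let ?\<pi> = "assign \<pi> a b q"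
  assume y: "y \<le> q"
  have "card (?\<pi> ` {v \<in> from_left a q. x \<le> r v \<and> r v < y}) \<le> card (\<pi> ` {v \<in> from_left a b. x \<le> r v \<and> r v < y})"
    using assms by (intro card_mono) (auto simp: assign_def seg_defs finite_chords)
  moreover have "card (?\<pi> ` {v \<in> from_right a q. x \<le> l v \<and> l v < y}) \<le> card (\<pi> ` {v \<in> from_right a b. x \<le> l v \<and> l v < y}) + 1"
    by (rule card_image_insert_le[where q = q])
      (use assms y in \<open>auto simp: assign_def seg_defs finite_chords\<close>)
  ultimately show "seen ?\<pi> a q x y \<le> seen \<pi> a b x y + 1"
    by (simp add: seen_def)
next
  let ?\<pi> = "assign \<pi> a b q"
  assume x: "q \<le> x"
  have "card (?\<pi> ` {v \<in> from_right q b. x \<le> l v \<and> l v < y}) \<le> card (\<pi> ` {v \<in> from_right a b. x \<le> l v \<and> l v < y})"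
    using assms by (intro card_mono) (auto simp: assign_def seg_defs finite_chords)
  moreover have "card (?\<pi> ` {v \<in> from_left q b. x \<le> r v \<and> r v < y}) \<le> card (\<pi> ` {v \<in> from_left a b. x \<le> r v \<and> r v < y}) + 1"
    by (rule card_image_insert_le[where q = q])
      (use assms x in \<open>auto simp: assign_def seg_defs finite_chords\<close>)
  ultimately show "seen ?\<pi> q b x y \<le> seen \<pi> a b x y + 1"
    by (simp add: seen_def)
qed

lemma seen_whole: "seen \<pi> a b a b = card (\<pi> ` from_left a b) + card (\<pi> ` from_right a b)"
  unfolding seen_def
  by (intro arg_cong2[where f = "(+)"] arg_cong[where f = card] image_cong refl) (auto simp: seg_defs)

lemma fresh_palette:
  assumes "seen \<pi> a b a b < P"
  obtains w where "w < P" "\<And>y. y \<in> from_left a b \<union> from_right a b \<Longrightarrow> p (\<pi> y) \<noteq> w"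
proof -
  have "card ((\<lambda>y. p (\<pi> y)) ` (from_left a b \<union> from_right a b)) \<le> seen \<pi> a b a b"
    unfolding seen_whole image_Un image_image[symmetric, of p \<pi>]
    by (rule order_trans[OF card_Un_le]) (intro add_mono card_image_le; simp)
  then have "\<not> {..<P} \<subseteq> (\<lambda>y. p (\<pi> y)) ` (from_left a b \<union> from_right a b)"
    using assms by (metis card_lessThan card_mono finite_UnI finite_imageI finite_seg(2,3) leD order_less_le_trans)
  then show thesis using that by blast
qed

text \<open>A chord inside one part crosses only chords with an end in that part, which the
  extension of this part takes care of. Chords on \<open>q\<close> share a pillar, and their palette
  \<open>w\<close> differs from those of the older pillars seen.\<close>

lemma extends_split:
  assumes ok: "pillars_ok \<pi> a b" and q: "a < q" "q < b"
    and w: "w < P" "\<And>y. y \<in> from_left a b \<union> from_right a b \<Longrightarrow> p (\<pi> y) \<noteq> w"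
    and 1: "extends P (assign \<pi> a b q) (p(q := w)) a q \<pi>1 p1"
    and 2: "extends P \<pi>1 p1 q b \<pi>2 p2"
  shows "extends P \<pi> p a b \<pi>2 p2"
proof -
  note e1 = extendsD[OF 1] and e2 = extendsD[OF 2]
  have out: "\<pi>2 x = \<pi> x" if "x \<notin> inside a b" for x
    using that q e1(1)[of x] e2(1)[of x] by (auto simp: assign_def seg_defs)
  have pout: "p2 c = p c" if "c \<notin> {a<..<b}" for c
    using that q e1(2)[of c] e2(2)[of c] by auto
  have mid: "\<pi>2 x = q" if "x \<in> inside a b" "l x < q" "q \<le> r x" for x
    using that q e1(1)[of x] e2(1)[of x] by (auto simp: assign_def seg_defs)
  have pmid: "p2 q = w"
    using q e1(2)[of q] e2(2)[of q] by auto
  have outok: "p2 (\<pi>2 y) = p (\<pi> y) \<and> \<pi>2 y = \<pi> y \<and> \<pi> y \<notin> {a<..<b}"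
    if "y \<in> from_left a b \<union> from_right a b" for y
  proof -
    have "y \<notin> inside a b" "\<pi> y \<notin> {a<..<b}"
      using that ok by (auto simp: pillars_ok_def seg_defs)
    then show ?thesis using out pout by simp
  qed
  \<comment> \<open>The right-hand extension changes palettes only strictly between \<open>q\<close>
    and \<open>b\<close>, where no chord with an end in the left part has its pillar.\<close>
  have left: "\<pi>2 x = \<pi>1 x \<and> p2 (\<pi>2 x) = p1 (\<pi>1 x)"
    if "x \<in> inside a q \<union> from_left a q \<union> from_right a q" for x
  proof -
    have x: "\<pi>2 x = \<pi>1 x" using that q e2(1)[of x] l_less_r[of x] by (auto simp: seg_defs)
    have "x \<in> inside a q \<or> x \<in> inside a b \<and> l x < q \<and> q \<le> r x
      \<or> x \<in> from_left a b \<union> from_right a b"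
      using that q by (auto simp: seg_defs)
    then have "\<pi>2 x \<notin> {q<..<b}"
    proof (elim disjE)
      assume xi: "x \<in> inside a q"
      then have "r x < q" by (simp add: inside_def)
      then show ?thesis using e1(3)[OF xi] x by simp
    next
      assume "x \<in> inside a b \<and> l x < q \<and> q \<le> r x"
      then show ?thesis using mid by simp
    next
      assume "x \<in> from_left a b \<union> from_right a b"
      then show ?thesis using outok q by simp
    qed
    then show ?thesis using x e2(2) by simp
  qed
  have key1: "\<pi>2 x = \<pi>2 y"
    if "x \<in> inside a q" "y \<in> inside a b \<union> from_left a b \<union> from_right a b"
       "crossing x y" "p2 (\<pi>2 x) = p2 (\<pi>2 y)" for x y
  proof -
    have y: "y \<in> inside a q \<union> from_left a q \<union> from_right a q"
      using that(1-3) l_less_r[of y] by (auto simp: seg_defs crossing_def)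
    then show ?thesis
      using e1(4)[OF that(1) y that(3)] left[of x] left[of y] that by auto
  qed
  have key2: "\<pi>2 x = \<pi>2 y"
    if "x \<in> inside q b" "y \<in> inside a b \<union> from_left a b \<union> from_right a b"
       "crossing x y" "p2 (\<pi>2 x) = p2 (\<pi>2 y)" for x y
  proof -
    have y: "y \<in> inside q b \<union> from_left q b \<union> from_right q b"
      using that(1-3) l_less_r[of y] by (auto simp: seg_defs crossing_def)
    then show ?thesis using e2(4)[OF that(1) y that(3)] that by auto
  qed
  have split: "x \<in> inside a q \<or> x \<in> inside q b \<or> l x < q \<and> q \<le> r x" if "x \<in> inside a b" for x
    using that q by (auto simp: seg_defs)
  show ?thesis
    unfolding extends_def
  proof (intro conjI allI impI ballI)
    show "\<pi>2 x = \<pi> x" if "x \<notin> inside a b" for x using out that .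
    show "p2 c = p c" if "c \<notin> {a<..<b}" for c using pout that .
  next
    fix x assume x: "x \<in> inside a b"
    have "l x < \<pi>2 x \<and> \<pi>2 x \<le> r x \<and> p2 (\<pi>2 x) < P"
      using split[OF x] e1(3)[of x] e2(3)[of x] left[of x] mid[OF x] pmid w(1) by auto
    then show "l x < \<pi>2 x" "\<pi>2 x \<le> r x" "p2 (\<pi>2 x) < P" by auto
  next
    fix x y assume x: "x \<in> inside a b"
      and y: "y \<in> inside a b \<union> from_left a b \<union> from_right a b"
      and cr: "crossing x y" and eq: "p2 (\<pi>2 x) = p2 (\<pi>2 y)"
    consider "x \<in> inside a q" | "x \<in> inside q b" | "l x < q" "q \<le> r x" using split[OF x] by blast
    then show "\<pi>2 x = \<pi>2 y"
    proof cases
      case 1 then show ?thesis using key1 y cr eq by blast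
    next
      case 2 then show ?thesis using key2 y cr eq by blast
    next
      case 3
      then have x': "\<pi>2 x = q" using mid x by simp
      show ?thesis
      proof (cases "y \<in> inside a b")
        case True
        consider "y \<in> inside a q" | "y \<in> inside q b" | "l y < q" "q \<le> r y" using split[OF True] by blast
        then show ?thesis
        proof cases
          case 1 then show ?thesis using key1[of y x] x cr eq crossing_sym[of x y] by auto
        next
          case 2 then show ?thesis using key2[of y x] x cr eq crossing_sym[of x y] by auto
        next
          case 3 then show ?thesis using mid True x' by simp
        qed
      next
        case False
        then have "p2 (\<pi>2 y) \<noteq> w" using y outok[of y] w(2)[of y] by auto
        then show ?thesis using x' pmid eq by simp
      qed
    qed
  qed
qed

end

section \<open>Cutting segments under a bound on cliques\<close>

text \<open>A segment to be cut sees at most \<open>K\<close> pillars and its tree has depth at most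
  \<open>D\<close>, so \<open>K + D\<close> palettes suffice. \<open>N\<close> is the number of
  subsegments used for averaging, and \<open>k\<close> stands for the number of pillars seen from a
  side that shows at least \<open>K / 2\<close>.\<close>

locale circle_bound = chord_system X l r
  for X :: "'a set" and l r :: "'a \<Rightarrow> nat" +
  fixes \<omega> K D N :: nat
  assumes clique_le: "\<lbrakk>Z \<subseteq> X; \<And>y z. \<lbrakk>y \<in> Z; z \<in> Z; y \<noteq> z\<rbrakk> \<Longrightarrow> crossing y z\<rbrakk> \<Longrightarrow> card Z \<le> \<omega>"
    and D: "1 \<le> D" "D \<le> K" and N: "N \<le> 2 ^ D"
    and averaging: "K \<le> 2 * k \<Longrightarrow> N \<le> k \<and> N * (D - 1) < (N - \<omega>) * (k - N + 1)"
begin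

text \<open>\<open>h\<close> is the end in the segment, \<open>f\<close> the end outside. By
  \<open>pillars_ok\<close> the pillars order the outer ends, so an increasing transversal consists
  of chords ordered alike at both ends. They all pass the same border of the segment, hence cross
  pairwise, against \<open>clique_le\<close>.\<close>

lemma no_missing:
  assumes Y: "Y = from_left a b \<and> h = r \<and> f = l \<or> Y = from_right a b \<and> h = l \<and> f = r"
    and ok: "pillars_ok \<pi> a b" and t: "mono t"
    and miss: "\<And>j. j < N \<Longrightarrow>
      card (\<pi> ` Y) \<le> card (\<pi> ` {y \<in> Y. t j \<le> h y \<and> h y < Suc (t (Suc j))}) + (D - 1)"
    and K: "K \<le> 2 * card (\<pi> ` Y)"
  shows False
proof -
  have YX: "Y \<subseteq> X" using Y by (auto simp: seg_defs)
  have inj: "inj_on h Y" using Y YX inj_l inj_r by (auto intro: inj_on_subset)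
  have ord: "f y < f z" if "y \<in> Y" "z \<in> Y" "\<pi> y < \<pi> z" for y z
    using that Y ok unfolding pillars_ok_def by (meson order_less_le_trans order_le_less_trans)
  obtain Z where Z: "Z \<subseteq> Y" "\<omega> < card Z"
    "\<And>y z. \<lbrakk>y \<in> Z; z \<in> Z; y \<noteq> z\<rbrakk> \<Longrightarrow> f y < f z \<and> h y < h z \<or> f z < f y \<and> h z < h y"
    using increasing_transversal[of Y h \<pi> f t N "D - 1" \<omega>]
      finite_subset[OF YX finite_chords] inj ord t miss averaging[OF K] by blast
  have meet: "l y < r z" if "y \<in> Y" "z \<in> Y" for y z
    using Y that by (elim disjE) (auto simp: seg_defs)
  have "crossing y z" if "y \<in> Z" "z \<in> Z" "y \<noteq> z" for y z
    using Z(3)[OF that] meet[of y z] meet[of z y] that Z(1) Y by (auto simp: crossing_def)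
  then have "card Z \<le> \<omega>" using Z(1) YX by (intro clique_le) auto
  then show False using Z(2) by simp
qed

text \<open>A leaf comes to see at most one new pillar per level, which the margin \<open>d\<close>
  allows for; the bound on lengths serves the later induction. Below \<open>K\<close> a single cut
  is enough. At \<open>K\<close>, failure gives successive subsegments each missing fewer than
  \<open>D\<close> pillars, and \<open>no_missing\<close> applies to the side that shows at least
  \<open>K / 2\<close>.\<close>

lemma cut_tree_exists:
  assumes ok: "pillars_ok \<pi> a b" and K: "seen \<pi> a b a b \<le> K" and ab: "a + 2 \<le> b"
  obtains d where "d \<le> D" "cut_tree (\<lambda>x y. seen \<pi> a b x y + d \<le> K \<and> y - x < b - a) d a b"
proof (cases "seen \<pi> a b a b = K")
  case False
  have le: "seen \<pi> a b x y \<le> seen \<pi> a b a b" for x y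
    unfolding seen_def
    by (intro add_mono card_mono image_mono) (auto simp: seg_defs finite_chords)
  have "cut_tree (\<lambda>x y. seen \<pi> a b x y + 1 \<le> K \<and> y - x < b - a) (Suc 0) a b"
    using le[of a "a+1"] le[of "a+1" b] ab False K by (auto intro!: exI[of _ "a + 1"])
  then show thesis using that[of 1] D by simp
next
  case True
  let ?Q = "\<lambda>x y. seen \<pi> a b x y + D \<le> K \<and> y - x < b - a"
  have "cut_tree ?Q D a b"
  proof (rule ccontr)
    assume no: "\<not> cut_tree ?Q D a b"
    have Qxx: "?Q x x" for x
    proof -
      have "{v \<in> A. x \<le> g v \<and> g v < x} = {}" for A and g :: "'a \<Rightarrow> nat" by auto
      then show ?thesis using D ab by (simp only: seen_def) simp
    qed
    obtain t where t: "t 0 = a" "mono t" "Suc (t (2 ^ D)) = b"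
      "\<And>j. j < 2 ^ D \<Longrightarrow> \<not> ?Q (t j) (Suc (t (Suc j)))"
      using no_cut_tree[OF no add_leD1[OF ab] Qxx] by blast
    let ?L = "\<lambda>x y. card (\<pi> ` {v \<in> from_left a b. x \<le> r v \<and> r v < y})"
    let ?R = "\<lambda>x y. card (\<pi> ` {v \<in> from_right a b. x \<le> l v \<and> l v < y})"
    let ?l = "card (\<pi> ` from_left a b)" and ?r = "card (\<pi> ` from_right a b)"
    have "?l \<le> ?L (t j) (Suc (t (Suc j))) + (D - 1) \<and> ?r \<le> ?R (t j) (Suc (t (Suc j))) + (D - 1)"
      if "j < N" for j
    proof -
      have j: "j < 2 ^ D" using that N by simp
      have bounds: "a \<le> t j" "Suc (t (Suc j)) \<le> b"
        using monoD[OF t(2), of 0 j] monoD[OF t(2), of "Suc j" "2 ^ D"] t j by auto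
      \<comment> \<open>A subsegment can also violate \<open>?Q\<close> by its length, but then it
        is the whole segment and sees \<open>K\<close> pillars.\<close>
      have "K < seen \<pi> a b (t j) (Suc (t (Suc j))) + D"
      proof (cases "Suc (t (Suc j)) - t j < b - a")
        case True
        then show ?thesis using t(4)[OF j] by auto
      next
        case False
        then have "t j = a" "Suc (t (Suc j)) = b" using bounds ab by auto
        then show ?thesis using True D by simp
      qed
      then have "?l + ?r < ?L (t j) (Suc (t (Suc j))) + ?R (t j) (Suc (t (Suc j))) + D"
        using True unfolding seen_whole unfolding seen_def by simp
      moreover have "?L (t j) (Suc (t (Suc j))) \<le> ?l" "?R (t j) (Suc (t (Suc j))) \<le> ?r"
        by (intro card_mono image_mono; auto)+
      ultimately show ?thesis using D(1) by linarith
    qed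
    then have "\<not> K \<le> 2 * ?l" "\<not> K \<le> 2 * ?r"
      using no_missing[of "from_left a b" a b r l, OF _ ok t(2)]
        no_missing[of "from_right a b" a b l r, OF _ ok t(2)] by auto
    then show False using True unfolding seen_whole by linarith
  qed
  then show thesis using that[of D] by simp
qed

text \<open>By induction on the length of the segment: cut it along a tree and apply the hypothesis
  to the leaves from left to right.\<close>

lemma extension_exists:
  assumes "pillars_ok \<pi> a b" "seen \<pi> a b a b \<le> K"
  shows "\<exists>\<pi>' p'. extends (K + D) \<pi> p a b \<pi>' p'"
  using assms
proof (induction "b - a" arbitrary: a b \<pi> p rule: less_induct)
  case less
  \<comment> \<open>The first bound on \<open>seen\<close> ends as the bound \<open>K\<close> at the
    leaves; the second leaves a palette free at every inner node. Each new pillar raises both counts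
    by at most one while \<open>d\<close> drops by one.\<close>
  have tree: "\<exists>\<pi>' p'. extends (K + D) \<pi> p x y \<pi>' p'"
    if "cut_tree (\<lambda>u v. seen \<pi> x y u v + d \<le> K \<and> v - u < b - a) d x y"
      "x \<le> y" "seen \<pi> x y x y + d \<le> K + D" "d \<le> D" "pillars_ok \<pi> x y" for d x y \<pi> p
    using that
  proof (induction d arbitrary: x y \<pi> p)
    case 0
    then show ?case using less.hyps[of y x \<pi> p] by simp
  next
    case (Suc d)
    from Suc.prems(1) obtain q where q: "x \<le> q" "q \<le> y"
      and T: "cut_tree (\<lambda>u v. seen \<pi> x y u v + Suc d \<le> K \<and> v - u < b - a) d x q"
        "cut_tree (\<lambda>u v. seen \<pi> x y u v + Suc d \<le> K \<and> v - u < b - a) d q y"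
      by auto
    show ?case
    proof (cases "q = x \<or> q = y")
      \<comment> \<open>A degenerate cut places no pillar; the level is skipped, which only weakens
        the demand on the leaves.\<close>
      case True
      then have "cut_tree (\<lambda>u v. seen \<pi> x y u v + Suc d \<le> K \<and> v - u < b - a) d x y"
        using T by auto
      then have "cut_tree (\<lambda>u v. seen \<pi> x y u v + d \<le> K \<and> v - u < b - a) d x y"
        by (rule cut_tree_mono) (use Suc.prems in auto)
      then show ?thesis using Suc.prems by (intro Suc.IH) auto
    next
      case False
      then have q: "x < q" "q < y" using q by auto
      obtain w where w: "w < K + D" "\<And>v. v \<in> from_left x y \<union> from_right x y \<Longrightarrow> p (\<pi> v) \<noteq> w"
        using fresh_palette[of \<pi> x y "K + D" p] Suc.prems(3) by auto
      let ?\<pi> = "assign \<pi> x y q"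
      note le = seen_assign_le[OF q, of _ \<pi>]
      have mono: "seen \<pi> x y u v \<le> seen \<pi> x y x y" for u v
        unfolding seen_def
        by (intro add_mono card_mono image_mono) (auto simp: seg_defs finite_chords)
      have "cut_tree (\<lambda>u v. seen ?\<pi> x q u v + d \<le> K \<and> v - u < b - a) d x q"
      proof (rule cut_tree_mono[OF T(1)])
        fix u v assume "v \<le> q" "seen \<pi> x y u v + Suc d \<le> K \<and> v - u < b - a"
        then show "seen ?\<pi> x q u v + d \<le> K \<and> v - u < b - a" using le(1)[of v u] by simp
      qed (use q in simp)
      moreover have "seen ?\<pi> x q x q + d \<le> K + D"
        using le(1)[of q x] mono[of x q] Suc.prems(3) by simp
      ultimately obtain \<pi>1 p1 where e1: "extends (K + D) ?\<pi> (p(q := w)) x q \<pi>1 p1"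
        using Suc.IH[of ?\<pi> x q "p(q := w)"] q Suc.prems(4,5) pillars_ok_assign(1)[OF _ q] by fastforce
      have eq: "seen \<pi>1 q y = seen ?\<pi> q y"
        by (rule seen_cong[OF extendsD(1)[OF e1]]) auto
      have "cut_tree (\<lambda>u v. seen \<pi>1 q y u v + d \<le> K \<and> v - u < b - a) d q y"
        unfolding eq
      proof (rule cut_tree_mono[OF T(2)])
        fix u v assume "q \<le> u" "seen \<pi> x y u v + Suc d \<le> K \<and> v - u < b - a"
        then show "seen ?\<pi> q y u v + d \<le> K \<and> v - u < b - a" using le(2)[of u v] by simp
      qed (use q in simp)
      moreover have "seen \<pi>1 q y q y + d \<le> K + D"
        unfolding eq using le(2)[of q y] mono[of q y] Suc.prems(3) by simp
      moreover have "pillars_ok \<pi>1 q y"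
        by (rule pillars_ok_cong[OF pillars_ok_assign(2)[OF Suc.prems(5) q] extendsD(1)[OF e1]]) auto
      ultimately obtain \<pi>2 p2 where e2: "extends (K + D) \<pi>1 p1 q y \<pi>2 p2"
        using Suc.IH[of \<pi>1 q y p1] q Suc.prems(4) by fastforce
      show ?thesis
        using extends_split[OF Suc.prems(5) q w e1 e2] by blast
    qed
  qed
  show ?case
  proof (cases "a + 2 \<le> b")
    case True
    obtain d where d: "d \<le> D" "cut_tree (\<lambda>x y. seen \<pi> a b x y + d \<le> K \<and> y - x < b - a) d a b"
      using cut_tree_exists[OF less.prems True] by blast
    show ?thesis using tree[OF d(2)] True d(1) less.prems by simp
  next
    case False
    then have "inside a b = {}" using l_less_r by (force simp: seg_defs)
    then show ?thesis by (intro exI[of _ \<pi>] exI[of _ p]) (auto simp: extends_def)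
  qed
qed

section \<open>Colouring with palettes\<close>

text \<open>Crossing is transitive from left to right among the chords on one pillar, so the largest
  clique ending at a chord is a proper colour.\<close>

lemma pillar_coloring:
  assumes "\<And>x. x \<in> X \<Longrightarrow> l x < \<pi> x \<and> \<pi> x \<le> r x"
  obtains e where "\<And>x. x \<in> X \<Longrightarrow> e x < \<omega>"
    "\<And>x y. \<lbrakk>x \<in> X; y \<in> X; crossing x y; \<pi> x = \<pi> y\<rbrakk> \<Longrightarrow> e x \<noteq> e y"
proof -
  define C where "C x = {Z. Z \<subseteq> X \<and> x \<in> Z \<and> (\<forall>y\<in>Z. \<pi> y = \<pi> x \<and> l y \<le> l x \<and> r y \<le> r x) \<and>
    (\<forall>y\<in>Z. \<forall>z\<in>Z. y \<noteq> z \<longrightarrow> crossing y z)}" for x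
  have fin: "finite (C x)" for x
    by (rule finite_subset[of _ "Pow X"]) (auto simp: C_def finite_chords)
  define h where "h x = Max (card ` C x)" for x
  have sing: "{x} \<in> C x" if "x \<in> X" for x using that by (auto simp: C_def)
  have ge: "card Z \<le> h x" if "Z \<in> C x" for x Z
    unfolding h_def using fin that by (intro Max_ge) auto
  have att: "\<exists>Z\<in>C x. h x = card Z" if "x \<in> X" for x
    using Max_in[of "card ` C x"] fin sing[OF that] unfolding h_def by blast
  have step: "h x < h y" if "x \<in> X" "y \<in> X" "\<pi> x = \<pi> y" "l x < l y" "r x < r y" for x y
  proof -
    obtain Z where Z: "Z \<in> C x" "h x = card Z" using att \<open>x \<in> X\<close> by blast
    \<comment> \<open>Both chords contain the pillar \<open>\<pi> y\<close>, hence
      \<open>l y < r z\<close>.\<close>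
    have cr: "crossing z y" if "z \<in> Z" for z
    proof -
      have "z \<in> X" "\<pi> z = \<pi> y" "l z \<le> l x" "r z \<le> r x" using Z(1) that \<open>\<pi> x = \<pi> y\<close> by (auto simp: C_def)
      then show ?thesis
        using assms[of z] assms[of y] \<open>y \<in> X\<close> \<open>l x < l y\<close> \<open>r x < r y\<close> by (auto simp: crossing_def)
    qed
    have "insert y Z \<in> C y"
      using Z(1) cr crossing_sym that by (fastforce simp: C_def)
    moreover have "y \<notin> Z" using Z(1) \<open>l x < l y\<close> by (auto simp: C_def)
    moreover have "finite Z" using Z(1) finite_chords by (auto simp: C_def intro: finite_subset)
    ultimately show ?thesis using ge[of "insert y Z" y] Z(2) by simp
  qed
  show thesis
  proof (rule that)
    fix x assume "x \<in> X"
    obtain Z where Z: "Z \<in> C x" "h x = card Z" using att \<open>x \<in> X\<close> by blast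
    have "card Z \<le> \<omega>" by (rule clique_le) (use Z in \<open>auto simp: C_def\<close>)
    then show "h x - 1 < \<omega>" using Z(2) ge[OF sing[OF \<open>x \<in> X\<close>]] by simp
  next
    fix x y assume xy: "x \<in> X" "y \<in> X" "crossing x y" "\<pi> x = \<pi> y"
    then have "h x \<noteq> h y" using step[of x y] step[of y x] by (auto simp: crossing_def)
    then show "h x - 1 \<noteq> h y - 1" using ge[OF sing[OF xy(1)]] ge[OF sing[OF xy(2)]] by simp
  qed
qed

text \<open>The colour encodes, in base \<open>\<omega>\<close>, the palette and the colour on the
  pillar. Crossing chords with equal palettes lie on one pillar, where the second component
  separates them.\<close>

lemma coloring_exists:
  obtains c where "\<And>x. x \<in> X \<Longrightarrow> c x < (K + D) * \<omega>"
    "\<And>x y. \<lbrakk>x \<in> X; y \<in> X; crossing x y\<rbrakk> \<Longrightarrow> c x \<noteq> c y"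
proof -
  obtain b where b: "\<And>x. x \<in> X \<Longrightarrow> r x < b"
    using finite_nat_bounded[of "r ` X"] finite_chords by blast
  have X: "inside 0 b = X" "from_left 0 b = {}" "from_right 0 b = {}"
    using b by (auto simp: seg_defs dest: leD)
  \<comment> \<open>The segment from \<open>0\<close> to \<open>b\<close> contains all chords and
    sees no pillar, so the initial maps are arbitrary.\<close>
  obtain \<pi> p where e: "extends (K + D) (\<lambda>_. 0) (\<lambda>_. 0) 0 b \<pi> p"
    using extension_exists[of "\<lambda>_. 0" 0 b "\<lambda>_. 0"] X by (auto simp: pillars_ok_def seen_whole)
  note e = extendsD[OF e, unfolded X]
  obtain h where h: "\<And>x. x \<in> X \<Longrightarrow> h x < \<omega>"
    "\<And>x y. \<lbrakk>x \<in> X; y \<in> X; crossing x y; \<pi> x = \<pi> y\<rbrakk> \<Longrightarrow> h x \<noteq> h y"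
    using pillar_coloring[of \<pi>] e(3) by blast
  show thesis
  proof (rule that)
    fix x assume x: "x \<in> X"
    have "p (\<pi> x) * \<omega> + h x < (p (\<pi> x) + 1) * \<omega>" using h(1)[OF x] by simp
    also have "\<dots> \<le> (K + D) * \<omega>" using e(3)[OF x] by (intro mult_le_mono1) simp
    finally show "p (\<pi> x) * \<omega> + h x < (K + D) * \<omega>" .
  next
    fix x y assume xy: "x \<in> X" "y \<in> X" "crossing x y"
    show "p (\<pi> x) * \<omega> + h x \<noteq> p (\<pi> y) * \<omega> + h y"
    proof
      assume eq: "p (\<pi> x) * \<omega> + h x = p (\<pi> y) * \<omega> + h y"
      have "p (\<pi> x) = (p (\<pi> x) * \<omega> + h x) div \<omega>" "p (\<pi> y) = (p (\<pi> y) * \<omega> + h y) div \<omega>"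
        using h(1)[OF xy(1)] h(1)[OF xy(2)] by auto
      then have "p (\<pi> x) = p (\<pi> y)" using eq by simp
      then show False using eq e(4)[of x y] xy h(2)[of x y] by auto
    qed
  qed
qed

end

section \<open>Numerical parameters\<close>

text \<open>The choice \<open>N = 2 * w\<close> and \<open>D = (3 * w + 5) div 5\<close> fails only for \<open>w = 3\<close>.\<close>

lemma averaging_parameters:
  assumes "0 < (w :: nat)"
  obtains D N where "1 \<le> D" "2 * D \<le> 7 * w" "N \<le> 2 ^ D"
    "\<And>k. 7 * w - D \<le> 2 * k \<Longrightarrow> N \<le> k \<and> N * (D - 1) < (N - w) * (k - N + 1)"
proof (cases "w = 3")
  case True
  \<comment> \<open>The general choice would give \<open>D = 2\<close> and
    \<open>N = 6 > 2 ^ D\<close>. With \<open>N = 4\<close>, the bound \<open>k \<ge> 10\<close>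
    yields \<open>4 < k - 3\<close>.\<close>
  show thesis by (rule that[of 2 4]) (use True in auto)
next
  case False
  define D where "D = (3 * w + 5) div 5"
  \<comment> \<open>From \<open>5\<close> on, raising \<open>w\<close> by \<open>5\<close>
    multiplies the right side by \<open>8\<close> and at most doubles the left side.\<close>
  have pow: "2 * w \<le> 2 ^ ((3 * w + 5) div 5)" if "5 \<le> w" for w :: nat
    using that
  proof (induction w rule: less_induct)
    case (less w)
    show ?case
    proof (cases "w < 10")
      case True
      then have "w \<in> {5, 6, 7, 8, 9}" using less.prems by auto
      then show ?thesis by auto
    next
      case False
      then have "2 * (w - 5) \<le> 2 ^ ((3 * (w - 5) + 5) div 5)" using less.IH[of "w - 5"] by simp
      moreover have "(3 * w + 5) div 5 = (3 * (w - 5) + 5) div 5 + 3" using False by linarith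
      ultimately show ?thesis using False by (simp add: power_add)
    qed
  qed
  have N: "2 * w \<le> 2 ^ D"
  proof (cases "5 \<le> w")
    case True then show ?thesis using pow by (simp add: D_def)
  next
    case 5: False
    then have "w \<in> {1, 2, 4}" using assms False by auto
    then show ?thesis by (auto simp: D_def)
  qed
  have D5: "5 * D \<le> 3 * w + 5" "1 \<le> D" using assms by (auto simp: D_def)
  show thesis
  proof (rule that[of D "2 * w"])
    fix k assume k: "7 * w - D \<le> 2 * k"
    have wk: "2 * w \<le> k" using k D5 assms by linarith
    \<comment> \<open>With \<open>N = 2 * w\<close> a factor \<open>w\<close> cancels. Given
      \<open>2 * k \<ge> 7 * w - D\<close>, what remains follows from
      \<open>5 * D < 3 * w + 6\<close>, which is where the value of \<open>D\<close> comes
      from.\<close>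
    have "2 * (D - 1) < k - 2 * w + 1" using k D5 wk by linarith
    then have "w * (2 * (D - 1)) < w * (k - 2 * w + 1)" using assms by (rule mult_strict_left_mono)
    then show "2 * w \<le> k \<and> 2 * w * (D - 1) < (2 * w - w) * (k - 2 * w + 1)"
      using wk by (simp add: mult.assoc mult.left_commute)
  qed (use D5 N assms in auto)
qed

section \<open>Interval systems and circle graphs\<close>

lemma overlap_iff:
  fixes a b c d :: real
  assumes "a < b" "c < d"
  shows "overlap {a<..<b} {c<..<d} \<longleftrightarrow> a < c \<and> c < b \<and> b < d \<or> c < a \<and> a < d \<and> d < b"
proof -
  have "{a<..<b} \<inter> {c<..<d} \<noteq> {} \<longleftrightarrow> max a c < min b d"
    by (auto simp: Int_greaterThanLessThan not_le)
  then show ?thesis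
    using assms unfolding overlap_def by (auto simp: greaterThanLessThan_subseteq_greaterThanLessThan)
qed

text \<open>Replacing every end by its rank among all ends keeps the order, so overlapping intervals
  become crossing chords. The parameters satisfy \<open>K + D = 7 * w\<close>.\<close>

lemma interval_system_coloring:
  assumes I: "interval_system \<I>" and "0 < w"
    and clique: "\<And>Z. \<lbrakk>Z \<subseteq> \<I>; \<And>J K. \<lbrakk>J \<in> Z; K \<in> Z; J \<noteq> K\<rbrakk> \<Longrightarrow> overlap J K\<rbrakk> \<Longrightarrow> card Z \<le> w"
  obtains c where "\<And>J. J \<in> \<I> \<Longrightarrow> c J < 7 * w\<^sup>2"
    "\<And>J K. \<lbrakk>J \<in> \<I>; K \<in> \<I>; overlap J K\<rbrakk> \<Longrightarrow> c J \<noteq> (c K :: nat)"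
proof -
  define E where "E = (\<Union>J\<in>\<I>. interval_ends J)"
  define pos where "pos x = card {e \<in> E. e < x}" for x
  define l r where "l J = pos (Inf J)" and "r J = pos (Sup J)" for J
  have finI: "finite \<I>" using I by (simp add: interval_system_def)
  then have finE: "finite E" by (auto simp: E_def interval_ends_def)
  have ends: "Inf J < Sup J \<and> J = {Inf J<..<Sup J}" if "J \<in> \<I>" for J
    using I that unfolding interval_system_def by fastforce
  have inE: "Inf J \<in> E" "Sup J \<in> E" if "J \<in> \<I>" for J
    using that by (auto simp: E_def interval_ends_def)
  have pos: "pos x < pos y \<longleftrightarrow> x < y" if "x \<in> E" "y \<in> E" for x y
  proof -
    have "pos x < pos y" if "x < y" "x \<in> E" for x y
      unfolding pos_def using finE that by (intro psubset_card_mono) auto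
    then show ?thesis using that by (metis linorder_neqE_linordered_idom order_less_asym)
  qed
  have pos_eq: "pos x = pos y \<longleftrightarrow> x = y" if "x \<in> E" "y \<in> E" for x y
    using pos[of x y] pos[of y x] that by (cases x y rule: linorder_cases) auto
  have distinct: "Inf J \<noteq> Inf K" "Sup J \<noteq> Sup K" if "J \<in> \<I>" "K \<in> \<I>" "J \<noteq> K" for J K
  proof -
    have "interval_ends J \<inter> interval_ends K = {}"
      using I that unfolding interval_system_def by meson
    then show "Inf J \<noteq> Inf K" "Sup J \<noteq> Sup K" by (auto simp: interval_ends_def)
  qed
  have inj: "inj_on l \<I>" "inj_on r \<I>"
    using distinct by (auto simp: inj_on_def l_def r_def pos_eq inE)
  interpret C: chord_system \<I> l r
    by unfold_locales (use finI ends inE inj in \<open>auto simp: l_def r_def pos\<close>)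
  have cross: "C.crossing J K \<longleftrightarrow> overlap J K" if "J \<in> \<I>" "K \<in> \<I>" for J K
    using overlap_iff[of "Inf J" "Sup J" "Inf K" "Sup K"] ends[OF that(1)] ends[OF that(2)] inE that
    by (simp add: C.crossing_def l_def r_def pos)
  obtain D N where D: "1 \<le> D" "2 * D \<le> 7 * w" "N \<le> 2 ^ D"
    and avg: "\<And>k. 7 * w - D \<le> 2 * k \<Longrightarrow> N \<le> k \<and> N * (D - 1) < (N - w) * (k - N + 1)"
    using averaging_parameters[OF \<open>0 < w\<close>] by metis
  interpret B: circle_bound \<I> l r w "7 * w - D" D N
  proof
    show "card Z \<le> w" if "Z \<subseteq> \<I>" "\<And>y z. \<lbrakk>y \<in> Z; z \<in> Z; y \<noteq> z\<rbrakk> \<Longrightarrow> C.crossing y z" for Z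
      using that cross by (intro clique) blast+
  qed (use D avg in auto)
  obtain c where "\<And>J. J \<in> \<I> \<Longrightarrow> c J < (7 * w - D + D) * w"
    "\<And>J K. \<lbrakk>J \<in> \<I>; K \<in> \<I>; C.crossing J K\<rbrakk> \<Longrightarrow> c J \<noteq> c K"
    using B.coloring_exists by blast
  moreover have "(7 * w - D + D) * w = 7 * w\<^sup>2" using D by (simp add: power2_eq_square)
  ultimately show thesis using that cross by auto
qed

theorem theorem1:
  fixes G :: "('a, 'b) pre_digraph"
  assumes "circle_graph G"
  shows "chromatic_number G \<le> 7 * (clique_number G)\<^sup>2"
proof -
  interpret graph G by (rule circle_graph_imp_graph[OF assms])
  obtain \<I> f where I: "interval_system \<I>" and f: "digraph_isomorphism f"
    and H: "with_proj (overlap_graph \<I>) = app_iso f G"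
    using assms by (auto simp: circle_graph_def digraph_iso_def)
  let ?g = "iso_verts f"
  have bij: "bij_betw ?g (verts G) \<I>"
  proof -
    have "?g ` verts G = \<I>" using arg_cong[OF H, of verts] by (simp add: overlap_graph_def)
    then show ?thesis using f by (simp add: bij_betw_def digraph_isomorphism_def)
  qed
  have adj: "u \<rightarrow>\<^bsub>G\<^esub> v \<longleftrightarrow> overlap (?g u) (?g v)" if "u \<in> verts G" "v \<in> verts G" for u v
  proof -
    have "parcs (overlap_graph \<I>) = (\<lambda>(u, v). (?g u, ?g v)) ` arcs_ends G"
      using arg_cong[OF H, of arcs_ends] f by (force simp: arcs_ends_app_iso_eq)
    moreover have "(?g u, ?g v) \<in> parcs (overlap_graph \<I>) \<longleftrightarrow> overlap (?g u) (?g v)"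
      using bij_betw_apply[OF bij] that by (simp add: overlap_graph_def)
    moreover have "(?g u, ?g v) \<in> (\<lambda>(u, v). (?g u, ?g v)) ` arcs_ends G \<longleftrightarrow> u \<rightarrow>\<^bsub>G\<^esub> v"
    proof -
      have "x = u \<and> y = v" if "x \<rightarrow>\<^bsub>G\<^esub> y" "?g x = ?g u" "?g y = ?g v" for x y
        using that adj_in_verts[OF that(1)] \<open>u \<in> verts G\<close> \<open>v \<in> verts G\<close> bij_betw_imp_inj_on[OF bij]
        by (auto dest: inj_onD)
      then show ?thesis by fastforce
    qed
    ultimately show ?thesis by simp
  qed
  have le: "card K \<le> clique_number G" if "clique G K" for K
    unfolding clique_number_def using clique_number_attained(1) that by (intro Max_ge) auto
  have "\<exists>c. proper_coloring G (7 * (clique_number G)\<^sup>2) c"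
  \<comment> \<open>Without vertices the clique number is \<open>0\<close>, whereas
    \<open>interval_system_coloring\<close> asks for a positive bound.\<close>
  proof (cases "verts G = {}")
    case True
    then show ?thesis by (auto simp: proper_coloring_def)
  next
    case False
    then obtain v where "v \<in> verts G" by blast
    then have pos: "0 < clique_number G" using le[of "{v}"] by (simp add: clique_def)
    have small: "card Z \<le> clique_number G"
      if Z: "Z \<subseteq> \<I>" "\<And>J K. \<lbrakk>J \<in> Z; K \<in> Z; J \<noteq> K\<rbrakk> \<Longrightarrow> overlap J K" for Z
    proof -
      obtain W where W: "W \<subseteq> verts G" "Z = ?g ` W"
        using Z(1) bij by (metis bij_betw_imp_surj_on subset_imageE)
      have inj: "inj_on ?g W" using bij W(1) by (auto simp: bij_betw_def intro: inj_on_subset)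
      have "u \<rightarrow>\<^bsub>G\<^esub> v" if "u \<in> W" "v \<in> W" "u \<noteq> v" for u v
      proof -
        have "overlap (?g u) (?g v)" using that W inj by (intro Z(2)) (auto dest: inj_onD)
        then show ?thesis using adj W(1) that by blast
      qed
      then have "clique G W" using W(1) by (simp add: clique_def)
      then show ?thesis using le[of W] W(2) inj by (simp add: card_image)
    qed
    obtain c where c: "\<And>J. J \<in> \<I> \<Longrightarrow> c J < 7 * (clique_number G)\<^sup>2"
      "\<And>J K. \<lbrakk>J \<in> \<I>; K \<in> \<I>; overlap J K\<rbrakk> \<Longrightarrow> c J \<noteq> (c K :: nat)"
      using interval_system_coloring[OF I pos small] by metis
    have "proper_coloring G (7 * (clique_number G)\<^sup>2) (c \<circ> ?g)"
      using c adj bij_betw_apply[OF bij] by (auto simp: proper_coloring_def)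
    then show ?thesis by blast
  qed
  then show ?thesis unfolding chromatic_number_def by (rule Least_le)
qed

end
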